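(* Let $p$ be an odd prime and let $F\colon\mathbb{F}_{p^n}\to\mathbb{F}_{p^n}$ be a planar function. Then $$\frac{p^n+1}{2}\le|\operatorname{Im}(F)|\le p^n-\frac12\left(\sqrt{4p^n-3}-1\right).$$ The lower bound is satisfied with equality if and only if $F$ is $2$-to-$1$ on $\mathbb{F}_{p^n}$, and the upper bound is satisfied with equality if and only if all but one element in the image set have a unique preimage.
   Context: For an odd prime $p$, $F\colon\mathbb{F}_{p^n}\to\mathbb{F}_{p^n}$ is planar if for every $a\in\mathbb{F}_{p^n}^*$ and every $b\in\mathbb{F}_{p^n}$ the equation $F(x+a)-F(x)=b$ has exactly one solution $x$. $F$ is called $2$-to-$1$ on $\mathbb{F}_{p^n}$ if exactly one element of $\mathbb{F}_{p^n}$ has exactly one preimage and $(p^n-1)/2$ elements have exactly $2$ preimages. $\operatorname{Im}(F)$ is the image set of $F$. *)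

theory Defs
  imports Complex_Main "HOL-Library.Cardinality" "HOL-Computational_Algebra.Primes"
begin

text \<open>
  The field with \<open>p ^ n\<close> elements is a type \<open>'a\<close> of the classes field and finite with
  \<open>CARD('a) = p ^ n\<close>. The parity of \<open>p\<close> is an assumption of the theorem, not of the
  definition of planarity.
\<close>

definition planar :: "('a :: {field, finite} \<Rightarrow> 'a) \<Rightarrow> bool" where
  "planar F \<longleftrightarrow> (\<forall>a b. a \<noteq> 0 \<longrightarrow> (\<exists>!x. F (x + a) - F x = b))"

definition two_to_one :: "('a :: {field, finite} \<Rightarrow> 'a) \<Rightarrow> bool" where
  "two_to_one F \<longleftrightarrow>
     (\<exists>!y. card (F -` {y}) = 1) \<and>
     real (card {y. card (F -` {y}) = 2}) = (real CARD('a) - 1) / 2"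

end

theory Submission
  imports Defs
begin

text \<open>
  Let \<open>q\<close> be the size of the field and \<open>N y\<close> the size of the fibre over \<open>y\<close>. Then
  \<open>\<Sum> N = q\<close>, and planarity gives \<open>\<Sum> N\<^sup>2 = 2 q - 1\<close>, because each of the \<open>q - 1\<close> nonzero
  differences \<open>a\<close> has exactly one \<open>x\<close> with \<open>F (x + a) = F x\<close>. The lower bound is
  \<open>\<Sum> (N - 1) (N - 2) \<ge> 0\<close> over the image. For the upper bound put \<open>k = N - 1\<close> and
  \<open>D = \<Sum> k = q - |Im F|\<close>; then \<open>q - 1 - D = \<Sum> k\<^sup>2 \<le> D\<^sup>2\<close>, which is quadratic in \<open>D\<close>, and
  equality means that at most one \<open>k\<close> is nonzero.
\<close>

text \<open>With \<open>D\<close> the total, the gap between the two sides is the sum of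
  \<open>k y * (D - k y)\<close>. All terms are nonnegative, so equality forces every
  \<open>k y\<close> to be 0 or \<open>D\<close>, which means that at most one of them is
  nonzero.\<close>

lemma sum_power2_le_power2_sum:
  fixes k :: "'b \<Rightarrow> real"
  assumes "finite A" and nonneg: "\<And>y. y \<in> A \<Longrightarrow> 0 \<le> k y"
  shows "(\<Sum>y\<in>A. (k y)\<^sup>2) \<le> (\<Sum>y\<in>A. k y)\<^sup>2"
    and "(\<Sum>y\<in>A. (k y)\<^sup>2) = (\<Sum>y\<in>A. k y)\<^sup>2 \<longleftrightarrow>
      (\<forall>y\<in>A. \<forall>z\<in>A. k y \<noteq> 0 \<longrightarrow> k z \<noteq> 0 \<longrightarrow> y = z)" (is "?eq \<longleftrightarrow> ?unique")
proof -
  define D where "D = (\<Sum>y\<in>A. k y)"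
  have gap: "(\<Sum>y\<in>A. k y * (D - k y)) = D\<^sup>2 - (\<Sum>y\<in>A. (k y)\<^sup>2)"
    by (simp add: right_diff_distrib sum_subtractf D_def power2_eq_square sum_distrib_right)
  have le_D: "k y \<le> D" if "y \<in> A" for y
    unfolding D_def using assms that by (intro member_le_sum) auto
  have term_nonneg: "0 \<le> k y * (D - k y)" if "y \<in> A" for y
    using nonneg[OF that] le_D[OF that] by simp
  show "(\<Sum>y\<in>A. (k y)\<^sup>2) \<le> (\<Sum>y\<in>A. k y)\<^sup>2"
    using gap sum_nonneg[of A "\<lambda>y. k y * (D - k y)"] term_nonneg by (simp add: D_def)
  have "?eq \<longleftrightarrow> (\<Sum>y\<in>A. k y * (D - k y)) = 0"
    using gap by (auto simp: D_def)
  also have "\<dots> \<longleftrightarrow> (\<forall>y\<in>A. k y = 0 \<or> k y = D)"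
    using \<open>finite A\<close> term_nonneg by (subst sum_nonneg_eq_0_iff) auto
  also have "\<dots> \<longleftrightarrow> ?unique"
  proof
    assume two_values: "\<forall>y\<in>A. k y = 0 \<or> k y = D"
    show ?unique
    proof (intro ballI impI, rule ccontr)
      fix y z
      assume yz: "y \<in> A" "z \<in> A" "k y \<noteq> 0" "k z \<noteq> 0" "y \<noteq> z"
      \<comment> \<open>Both values equal \<open>D\<close>, so this bound reads 2 \<open>D\<close>
        \<le> \<open>D\<close>, impossible for positive \<open>D\<close>.\<close>
      have "sum k {y, z} \<le> D"
        unfolding D_def using assms yz by (intro sum_mono2) auto
      then have "k y + k z \<le> D" using yz by simp
      moreover have "k y = D" "k z = D" using two_values yz by auto
      ultimately show False using nonneg[of y] yz by simp
    qed
  next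
    assume unique: ?unique
    show "\<forall>y\<in>A. k y = 0 \<or> k y = D"
    proof (intro ballI disjCI)
      fix y assume y: "y \<in> A" "k y \<noteq> D"
      show "k y = 0"
      proof (rule ccontr)
        assume "k y \<noteq> 0"
        then have "sum k (A - {y}) = 0"
          using unique y by (intro sum.neutral) auto
        then have "D = k y"
          unfolding D_def using sum.remove[OF \<open>finite A\<close> y(1), of k] by simp
        with y show False by simp
      qed
    qed
  qed
  finally show "?eq \<longleftrightarrow> ?unique" .
qed

lemma sum_card_fibres:
  fixes F :: "'a :: finite \<Rightarrow> 'b"
  shows "(\<Sum>y\<in>range F. card (F -` {y})) = CARD('a)"
proof -
  have "CARD('a) = (\<Sum>y\<in>range F. \<Sum>x | x \<in> UNIV \<and> F x = y. 1)"
    using sum.image_gen[of UNIV "\<lambda>_. 1 :: nat" F] by simp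
  then show ?thesis by (simp add: vimage_def)
qed

text \<open>Collisions are grouped by their common value; each group is the square of a
  fibre.\<close>

lemma sum_card_fibres_power2:
  fixes F :: "'a :: finite \<Rightarrow> 'b"
  shows "(\<Sum>y\<in>range F. (card (F -` {y}))\<^sup>2) = card {(u, v). F u = F v}"
proof -
  have "{(u, v). F u = F v} = (\<Union>y\<in>range F. F -` {y} \<times> F -` {y})" by auto
  also have "card \<dots> = (\<Sum>y\<in>range F. card (F -` {y} \<times> F -` {y}))"
    by (intro card_UN_disjoint) auto
  finally show ?thesis by (simp add: card_cartesian_product power2_eq_square)
qed

text \<open>Here the same collisions are grouped by the difference \<open>a = v - u\<close>. The
  class \<open>a = 0\<close> is the whole diagonal; planarity with \<open>b = 0\<close> leaves one
  pair in every other class.\<close>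

lemma planar_card_collisions:
  fixes F :: "'a :: {field, finite} \<Rightarrow> 'a"
  assumes "planar F"
  shows "card {(u, v). F u = F v} = 2 * CARD('a) - 1"
proof -
  have one: "card {x. F (x + a) = F x} = 1" if "a \<noteq> 0" for a
  proof -
    have "\<exists>!x. F (x + a) - F x = 0"
      using assms that unfolding planar_def by blast
    then show ?thesis by (auto simp: card_1_singleton_iff)
  qed
  have "bij_betw (\<lambda>(a, x). (x, x + a)) (SIGMA a:UNIV. {x. F (x + a) = F x}) {(u, v). F u = F v}"
    by (rule bij_betw_byWitness[where f' = "\<lambda>(u, v). (v - u, u)"]) auto
  then have "card {(u, v). F u = F v} = (\<Sum>a\<in>UNIV. card {x. F (x + a) = F x})"
    by (simp flip: bij_betw_same_card)
  also have "\<dots> = CARD('a) + (\<Sum>a\<in>UNIV - {0}. card {x. F (x + a) = F x})"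
    by (subst sum.remove[of _ 0]) auto
  also have "(\<Sum>a\<in>UNIV - {0}. card {x. F (x + a) = F x}) = (\<Sum>a\<in>UNIV - {0 :: 'a}. 1)"
    by (intro sum.cong) (auto simp: one)
  also have "\<dots> = CARD('a) - 1" by (simp add: card_Diff_singleton)
  finally show ?thesis by simp
qed

lemma planar_image_bounds:
  fixes F :: "'a :: {field, finite} \<Rightarrow> 'a"
  assumes "planar F"
  shows planar_image_lower: "(real CARD('a) + 1) / 2 \<le> real (card (range F))"
    and planar_image_lower_eq_iff:
      "(real CARD('a) + 1) / 2 = real (card (range F)) \<longleftrightarrow> two_to_one F"
    and planar_image_upper:
      "real (card (range F)) \<le> real CARD('a) - 1 / 2 * (sqrt (4 * real CARD('a) - 3) - 1)"
    and planar_image_upper_eq_iff: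
      "real (card (range F)) = real CARD('a) - 1 / 2 * (sqrt (4 * real CARD('a) - 3) - 1)
        \<longleftrightarrow> (\<exists>!y. y \<in> range F \<and> \<not> (\<exists>!x. F x = y))"
proof -
  define q m where "q = real CARD('a)" and "m = real (card (range F))"
  define N where "N y = real (card (F -` {y}))" for y
  \<comment> \<open>This makes the truncated subtraction in the collision count harmless, and
    \<open>q\<close> \<noteq> 1 is what later guarantees a fibre with more than one point.\<close>
  have "card {0, 1 :: 'a} \<le> CARD('a)" by (intro card_mono) auto
  then have "2 \<le> CARD('a)" by simp
  then have q: "2 \<le> q" by (simp add: q_def)
  have sum_N: "(\<Sum>y\<in>range F. N y) = q"
    unfolding N_def q_def by (simp flip: sum_card_fibres[of F])
  have "(\<Sum>y\<in>range F. (N y)\<^sup>2) = real (2 * CARD('a) - 1)"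
    unfolding N_def planar_card_collisions[OF assms, symmetric]
    by (simp flip: sum_card_fibres_power2)
  then have sum_N2: "(\<Sum>y\<in>range F. (N y)\<^sup>2) = 2 * q - 1"
    using \<open>2 \<le> CARD('a)\<close> by (simp add: q_def of_nat_diff)
  have in_range_iff: "y \<in> range F \<longleftrightarrow> card (F -` {y}) \<noteq> 0" for y
    by (auto simp: vimage_def)
  then have N_ge_1: "1 \<le> N y" if "y \<in> range F" for y
    using that by (simp add: N_def Suc_le_eq card_gt_0_iff)

  \<comment> \<open>The quadratic vanishes exactly at the fibre sizes 1 and 2, and the two known
    moments of \<open>N\<close> evaluate its sum.\<close>
  have lower_gap: "(\<Sum>y\<in>range F. (N y - 1) * (N y - 2)) = 2 * m - (q + 1)"
  proof -
    have "(\<Sum>y\<in>range F. (N y - 1) * (N y - 2)) = (\<Sum>y\<in>range F. (N y)\<^sup>2 - 3 * N y + 2)"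
      by (simp add: algebra_simps power2_eq_square)
    also have "\<dots> = (2 * q - 1) - 3 * q + 2 * m"
      by (simp add: sum.distrib sum_subtractf sum_N sum_N2 m_def flip: sum_distrib_left)
    finally show ?thesis by simp
  qed
  \<comment> \<open>The quadratic is negative only strictly between 1 and 2, where no integer
    lies.\<close>
  have lower_term_nonneg: "0 \<le> (N y - 1) * (N y - 2)" if "y \<in> range F" for y
  proof (cases "card (F -` {y}) = 1")
    case False
    then have "2 \<le> card (F -` {y})" using that in_range_iff[of y] by linarith
    then have "2 \<le> N y" by (simp add: N_def)
    then show ?thesis by simp
  qed (simp add: N_def)
  show "(real CARD('a) + 1) / 2 \<le> real (card (range F))"
    using sum_nonneg[of "range F" "\<lambda>y. (N y - 1) * (N y - 2)"] lower_term_nonneg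
    by (simp add: lower_gap flip: q_def m_def)

  let ?S = "\<lambda>i. {y. card (F -` {y}) = i}"
  have S_subset: "?S 1 \<union> ?S 2 \<subseteq> range F" using in_range_iff by auto
  have card_S: "real (card (?S 1)) + real (card (?S 2)) = real (card (?S 1 \<union> ?S 2))"
    by (subst card_Un_disjoint) auto
  have sum_S: "(\<Sum>y\<in>?S 1 \<union> ?S 2. N y) = real (card (?S 1)) + 2 * real (card (?S 2))"
    by (subst sum.union_disjoint) (auto simp: N_def)
  \<comment> \<open>Used for the unique value in \<open>two_to_one\<close> and again for unique
    preimages in \<open>k_eq_0_iff\<close>.\<close>
  have card_1_iff: "card A = 1 \<longleftrightarrow> (\<exists>!y. y \<in> A)" for A :: "'a set"
    unfolding card_1_singleton_iff One_nat_def set_eq_iff singleton_iff by auto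
  from card_1_iff[of "?S 1"] have two_to_one_iff: "two_to_one F \<longleftrightarrow> card (?S 1) = 1 \<and> real (card (?S 2)) = (q - 1) / 2"
    by (simp add: two_to_one_def q_def)
  have "(q + 1) / 2 = m \<longleftrightarrow> two_to_one F"
  proof
    assume "(q + 1) / 2 = m"
    then have "(\<Sum>y\<in>range F. (N y - 1) * (N y - 2)) = 0" using lower_gap by simp
    then have "\<forall>y\<in>range F. (N y - 1) * (N y - 2) = 0"
      using lower_term_nonneg by (subst (asm) sum_nonneg_eq_0_iff) auto
    then have S: "?S 1 \<union> ?S 2 = range F" using S_subset by (auto simp: N_def)
    \<comment> \<open>Counting points and counting values gives two linear equations, which
      determine both cardinalities once \<open>m\<close> is known.\<close>
    then have "real (card (?S 1)) + 2 * real (card (?S 2)) = q"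
      "real (card (?S 1)) + real (card (?S 2)) = m"
      using card_S sum_S sum_N by (simp_all add: m_def)
    with \<open>(q + 1) / 2 = m\<close> have "real (card (?S 1)) = 1" "real (card (?S 2)) = (q - 1) / 2"
      by argo+
    then show "two_to_one F" by (simp add: two_to_one_iff)
  next
    assume "two_to_one F"
    then have S: "real (card (?S 1)) = 1" "real (card (?S 2)) = (q - 1) / 2"
      by (simp_all add: two_to_one_iff)
    \<comment> \<open>The fibres of sizes 1 and 2 already contain 1 + (\<open>q\<close> - 1) =
      \<open>q\<close> points, so nothing is left for other values, whose fibres would be
      nonempty.\<close>
    have rest: "(\<Sum>y\<in>range F - (?S 1 \<union> ?S 2). N y) = 0"
      using sum.subset_diff[OF S_subset, of N] S sum_S sum_N by simp
    have "N y = 0" if "y \<in> range F - (?S 1 \<union> ?S 2)" for y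
      by (rule sum_nonneg_0[OF _ _ rest that]) (simp_all add: N_def)
    then have "range F - (?S 1 \<union> ?S 2) = {}" using N_ge_1 by force
    then have "range F = ?S 1 \<union> ?S 2" using S_subset by blast
    then show "(q + 1) / 2 = m" using card_S S by (simp add: m_def field_simps)
  qed
  then show "(real CARD('a) + 1) / 2 = real (card (range F)) \<longleftrightarrow> two_to_one F"
    by (simp add: q_def m_def)

  define k where "k y = N y - 1" for y
  define D where "D = q - m"
  have sum_k: "(\<Sum>y\<in>range F. k y) = D"
    by (simp add: k_def D_def sum_subtractf sum_N m_def)
  have sum_k2: "(\<Sum>y\<in>range F. (k y)\<^sup>2) = q - 1 - D"
  proof -
    have "(\<Sum>y\<in>range F. (k y)\<^sup>2) = (\<Sum>y\<in>range F. (N y)\<^sup>2 - 2 * N y + 1)"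
      by (simp add: k_def algebra_simps power2_eq_square)
    also have "\<dots> = (2 * q - 1) - 2 * q + m"
      by (simp add: sum.distrib sum_subtractf sum_N sum_N2 m_def flip: sum_distrib_left)
    finally show ?thesis by (simp add: D_def)
  qed
  have k_nonneg: "0 \<le> k y" if "y \<in> range F" for y
    using N_ge_1[OF that] by (simp add: k_def)
  have D_nonneg: "0 \<le> D" unfolding sum_k[symmetric] using k_nonneg by (rule sum_nonneg)
  have k_eq_0_iff: "k y = 0 \<longleftrightarrow> (\<exists>!x. F x = y)" for y
    using card_1_iff[of "F -` {y}"] by (simp add: k_def N_def)
  \<comment> \<open>Completing the square turns \<open>q - 1 - D\<close> \<le>
    \<open>D\<^sup>2\<close> into a comparison of \<open>4 * q - 3\<close> with the square of
    \<open>2 * D + 1\<close>; as \<open>D\<close> \<ge> 0, roots can be taken, also in the equality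
    case.\<close>
  have complete_square: "(2 * D + 1)\<^sup>2 = 4 * (D\<^sup>2 - (q - 1 - D)) + (4 * q - 3)"
    by (simp add: power2_eq_square algebra_simps)
  have "q - 1 - D \<le> D\<^sup>2"
    using sum_power2_le_power2_sum(1)[of "range F" k] k_nonneg by (simp add: sum_k sum_k2)
  then have "sqrt (4 * q - 3) \<le> 2 * D + 1"
    using D_nonneg complete_square by (intro real_le_lsqrt) auto
  then show "real (card (range F)) \<le> real CARD('a) - 1 / 2 * (sqrt (4 * real CARD('a) - 3) - 1)"
    unfolding q_def[symmetric] m_def[symmetric] by (simp add: D_def field_simps)

  have "m = q - 1 / 2 * (sqrt (4 * q - 3) - 1) \<longleftrightarrow> sqrt (4 * q - 3) = 2 * D + 1"
    by (auto simp: D_def field_simps)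
  also have "\<dots> \<longleftrightarrow> 4 * q - 3 = (2 * D + 1)\<^sup>2"
    using D_nonneg by (subst real_sqrt_eq_iff[of _ "(2 * D + 1)\<^sup>2", symmetric]) simp
  also have "\<dots> \<longleftrightarrow> q - 1 - D = D\<^sup>2" using complete_square by auto
  also have "\<dots> \<longleftrightarrow> (\<forall>y\<in>range F. \<forall>z\<in>range F. k y \<noteq> 0 \<longrightarrow> k z \<noteq> 0 \<longrightarrow> y = z)"
    using sum_power2_le_power2_sum(2)[of "range F" k] k_nonneg by (simp add: sum_k sum_k2)
  also have "\<dots> \<longleftrightarrow> (\<exists>!y. y \<in> range F \<and> k y \<noteq> 0)"
  proof -
    \<comment> \<open>The preceding condition says only "at most one". If every \<open>k y\<close>
      were 0, both sums would vanish, giving \<open>D = 0\<close> and then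
      \<open>q = 1\<close>.\<close>
    have "\<exists>y\<in>range F. k y \<noteq> 0"
    proof (rule ccontr)
      assume "\<not> ?thesis"
      then have "(\<Sum>y\<in>range F. k y) = 0" "(\<Sum>y\<in>range F. (k y)\<^sup>2) = 0"
        by (auto intro!: sum.neutral)
      with q show False by (simp add: sum_k sum_k2)
    qed
    then show ?thesis by blast
  qed
  finally show "real (card (range F)) = real CARD('a) - 1 / 2 * (sqrt (4 * real CARD('a) - 3) - 1)
      \<longleftrightarrow> (\<exists>!y. y \<in> range F \<and> \<not> (\<exists>!x. F x = y))"
    by (simp add: k_eq_0_iff q_def m_def)
qed

theorem proposition6p1:
  fixes F :: "'a :: {field, finite} \<Rightarrow> 'a" and p n :: nat
  assumes "prime p" and "odd p" and "n \<ge> 1"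
    and "CARD('a) = p ^ n"
    and "planar F"
  shows "(real (p ^ n) + 1) / 2 \<le> real (card (range F))
    \<and> real (card (range F)) \<le> real (p ^ n) - 1 / 2 * (sqrt (4 * real (p ^ n) - 3) - 1)
    \<and> ((real (p ^ n) + 1) / 2 = real (card (range F)) \<longleftrightarrow> two_to_one F)
    \<and> (real (card (range F)) = real (p ^ n) - 1 / 2 * (sqrt (4 * real (p ^ n) - 3) - 1)
        \<longleftrightarrow> (\<exists>!y. y \<in> range F \<and> \<not> (\<exists>!x. F x = y)))"
  unfolding \<open>CARD('a) = p ^ n\<close>[symmetric]
  using planar_image_bounds[OF \<open>planar F\<close>] by blast

end
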